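(* Let $b, r > 0$ be real numbers. Then $$\int_{0}^{b} \frac{\ln x \, dx}{x+r} = \ln b \, \ln \left( \frac{b+r}{r} \right) + \mathrm{Li}_{2} \left( - \frac{b}{r} \right).$$
   Context: $\mathrm{Li}_{2}$ is the dilogarithm function, given by $\mathrm{Li}_{2}(x) = \sum_{k=1}^{\infty} \frac{x^{k}}{k^{2}}$ for $|x| \le 1$ and, for all real $x \le 1$, by the analytic continuation $\mathrm{Li}_{2}(x) = -\int_{0}^{x} \frac{\ln(1-t)}{t}\, dt$. *)

theory Defs
  imports "HOL-Analysis.Analysis"
begin

(* Only meaningful for x \<le> 1.  For x < 0 the interval integral is oriented, i.e. it is minus
   the integral over (x, 0); the value of the integrand at t = 0 is irrelevant. *)
definition Li2 :: "real \<Rightarrow> real" where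
  "Li2 x = - (LBINT t=0..x. ln (1 - t) / t)"

(* The series representation on [-1, 1] is proved as Li2_sums below. *)

lemma summable_inverse_squares_times_power:
  fixes x :: real
  assumes "\<bar>x\<bar> \<le> 1"
  shows "summable (\<lambda>n. 1 / (real n)\<^sup>2 * x ^ n)"
proof (rule summable_comparison_test')
  show "summable (\<lambda>n. 1 / (real n)\<^sup>2)"
    using inverse_power_summable[of 2, where 'a = real] by (simp add: inverse_eq_divide)
  show "norm (1 / (real n)\<^sup>2 * x ^ n) \<le> 1 / (real n)\<^sup>2" if "n \<ge> 0" for n
    using assms by (simp add: abs_mult power_abs power_le_one divide_le_cancel)
qed

lemma dilog_series_deriv:
  fixes x :: real
  assumes "\<bar>x\<bar> < 1" "x \<noteq> 0"
  shows "((\<lambda>x. \<Sum>n. 1 / (real n)\<^sup>2 * x ^ n) has_real_derivative - (ln (1 - x) / x)) (at x)"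
proof -
  have "((\<lambda>x. \<Sum>n. 1 / (real n)\<^sup>2 * x ^ n) has_real_derivative
      (\<Sum>n. diffs (\<lambda>n. 1 / (real n)\<^sup>2) n * x ^ n)) (at x)"
    using assms
    by (intro termdiffs_strong[where K = 1] summable_inverse_squares_times_power) auto
  moreover have "(\<Sum>n. diffs (\<lambda>n. 1 / (real n)\<^sup>2) n * x ^ n) = - (ln (1 - x) / x)"
  proof -
    let ?f = "\<lambda>n. diffs (\<lambda>n. 1 / (real n)\<^sup>2) n * x ^ n"
    have eq: "(- 1) ^ n * (1 / real (n + 1)) * (1 - x - 1) ^ Suc n = - x * ?f n" for n
    proof -
      have "(- 1) ^ n * (- x) ^ Suc n = - x * ((- 1) * (- x)) ^ n"
        by (simp only: power_mult_distrib power_Suc mult_ac)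
      also have "\<dots> = - x * x ^ n"
        by simp
      finally have pow: "(- 1) ^ n * (- x) ^ Suc n = - x * x ^ n" .
      have "(- 1) ^ n * (1 / real (n + 1)) * (1 - x - 1) ^ Suc n =
          ((- 1) ^ n * (- x) ^ Suc n) / real (Suc n)"
        by simp
      also have "\<dots> = - x * (x ^ n / real (Suc n))"
        unfolding pow by simp
      also have "x ^ n / real (Suc n) = ?f n"
        by (simp add: diffs_def power2_eq_square)
      finally show ?thesis .
    qed
    have "ln (1 - x) = (\<Sum>n. - x * ?f n)"
      using ln_series[of "1 - x"] assms unfolding eq by simp
    also have "\<dots> = - x * (\<Sum>n. ?f n)"
      using assms
      by (intro suminf_mult termdiff_converges[where K = 1]
            summable_inverse_squares_times_power) auto
    finally show ?thesis using assms by simp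
  qed
  ultimately show ?thesis by simp
qed

lemma continuous_on_dilog_series:
  "continuous_on {-1..1} (\<lambda>x::real. \<Sum>n. 1 / (real n)\<^sup>2 * x ^ n)"
proof (rule uniform_limit_theorem)
  show "uniform_limit {-1..1} (\<lambda>m x::real. \<Sum>n<m. 1 / (real n)\<^sup>2 * x ^ n)
      (\<lambda>x. \<Sum>n. 1 / (real n)\<^sup>2 * x ^ n) sequentially"
  proof (rule Weierstrass_m_test)
    show "summable (\<lambda>n. 1 / (real n)\<^sup>2)"
      using inverse_power_summable[of 2, where 'a = real] by (simp add: inverse_eq_divide)
    show "norm (1 / (real n)\<^sup>2 * x ^ n) \<le> 1 / (real n)\<^sup>2" if "x \<in> {-1..1}" for n and x :: real
    proof -
      have "\<bar>x\<bar> \<le> 1" using that by auto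
      thus ?thesis by (simp add: abs_mult power_abs power_le_one divide_le_cancel)
    qed
  qed
  show "\<forall>\<^sub>F m in sequentially. continuous_on {-1..1} (\<lambda>x::real. \<Sum>n<m. 1 / (real n)\<^sup>2 * x ^ n)"
    by (intro always_eventually allI continuous_intros)
qed simp

lemma dilog_integral_eq_series_diff:
  fixes a b :: real
  assumes ab: "-1 \<le> a" "a < b" "b \<le> 1" "a \<ge> 0 \<or> b \<le> 0"
  shows "set_integrable lborel (einterval a b) (\<lambda>t. - (ln (1 - t) / t))" (is ?int)
    and "(LBINT t=a..b. - (ln (1 - t) / t)) =
      (\<Sum>n. 1 / (real n)\<^sup>2 * b ^ n) - (\<Sum>n. 1 / (real n)\<^sup>2 * a ^ n)" (is ?eq)
proof -
  let ?F = "\<lambda>x::real. \<Sum>n. 1 / (real n)\<^sup>2 * x ^ n"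
  have cont: "continuous_on {a..b} ?F"
    using ab by (intro continuous_on_subset[OF continuous_on_dilog_series]) auto
  have nonneg: "0 \<le> - (ln (1 - t) / t)" if "a < t" "t < b" for t
    using that ab by (cases "t > 0") (auto simp: divide_le_0_iff)
  have A: "((?F \<circ> real_of_ereal) \<longlongrightarrow> ?F a) (at_right (ereal a))"
    using cont ab unfolding ereal_tendsto_simps1
    by (intro continuous_on_Icc_at_rightD[of a b]) auto
  have B: "((?F \<circ> real_of_ereal) \<longlongrightarrow> ?F b) (at_left (ereal b))"
    using cont ab unfolding ereal_tendsto_simps1
    by (intro continuous_on_Icc_at_leftD[of a b]) auto
  have D: "DERIV ?F x :> - (ln (1 - x) / x)" if "ereal a < ereal x" "ereal x < ereal b" for x
    using that ab by (intro dilog_series_deriv) auto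
  have C: "isCont (\<lambda>x. - (ln (1 - x) / x)) x" if "ereal a < ereal x" "ereal x < ereal b" for x
    using that ab by (intro continuous_intros) auto
  have N: "AE x in lborel. ereal a < ereal x \<longrightarrow> ereal x < ereal b \<longrightarrow> 0 \<le> - (ln (1 - x) / x)"
    using nonneg by auto
  have less: "ereal a < ereal b" using ab by simp
  show ?int
    by (rule interval_integral_FTC_nonneg(1)[where F = ?F, OF less D C N A B])
  show ?eq
    by (rule interval_integral_FTC_nonneg(2)[where F = ?F, OF less D C N A B])
qed

lemma Li2_sums:
  assumes "\<bar>x\<bar> \<le> 1"
  shows "(\<lambda>k. x ^ Suc k / (real (Suc k))\<^sup>2) sums Li2 x"
proof -
  let ?F = "\<lambda>x::real. \<Sum>n. 1 / (real n)\<^sup>2 * x ^ n"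
  have F0: "?F 0 = 0"
    using powser_zero[of "\<lambda>n. 1 / (real n)\<^sup>2"] by simp
  have neg: "Li2 x = (LBINT t=ereal 0..ereal x. - (ln (1 - t) / t))" for x
    unfolding Li2_def zero_ereal_def by (rule interval_lebesgue_integral_uminus[symmetric])
  have "Li2 x = ?F x"
  proof (cases x "0 :: real" rule: linorder_cases)
    case less
    with assms have "(LBINT t=ereal x..ereal 0. - (ln (1 - t) / t)) = ?F 0 - ?F x"
      by (intro dilog_integral_eq_series_diff) auto
    with F0 show ?thesis
      unfolding neg interval_integral_endpoints_reverse[of "ereal 0" "ereal x"] by linarith
  next
    case equal
    thus ?thesis
      using F0 by (simp add: neg)
  next
    case greater
    with assms have "(LBINT t=ereal 0..ereal x. - (ln (1 - t) / t)) = ?F x - ?F 0"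
      by (intro dilog_integral_eq_series_diff) auto
    with F0 show ?thesis
      unfolding neg by linarith
  qed
  hence "(\<lambda>n. 1 / (real n)\<^sup>2 * x ^ n) sums Li2 x"
    using summable_sums[OF summable_inverse_squares_times_power[OF assms]] by simp
  thus ?thesis
    using sums_Suc_iff[of "\<lambda>n. 1 / (real n)\<^sup>2 * x ^ n" "Li2 x"] by simp
qed

end

theory Submission
  imports Defs "HOL-Real_Asymp.Real_Asymp"
begin

text \<open>
  Since \<open>Li2' t = - ln (1 - t) / t\<close>, integration by parts shows that
  \<open>G x = (ln b - ln x) * ln ((x + r) / r) - Li2 (- (x / r))\<close> is an antiderivative of
  \<open>(ln b - ln x) / (x + r)\<close> on \<open>(0, b)\<close>. The constant \<open>ln b\<close> makes this integrand nonnegative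
  there, so the fundamental theorem of calculus, applied with the limits of \<open>G\<close> at the endpoints,
  yields absolute integrability along with the value: \<open>G\<close> tends to \<open>0\<close> at \<open>0\<close>, because
  \<open>ln x * ln (1 + x / r)\<close> does, and to \<open>- Li2 (- (b / r))\<close> at \<open>b\<close>. Subtracting the result from the
  elementary integral of \<open>ln b / (x + r)\<close> gives the formula.

  As \<open>b / r\<close> may exceed \<open>1\<close>, the derivative of \<open>Li2\<close> must be obtained from the integral
  that defines it and not from its power series (\<open>Li2_has_real_derivative\<close>).
\<close>

text \<open>
  The singularity of \<open>ln (1 - t) / t\<close> at \<open>0\<close> is removable, its limit being the derivative \<open>-1\<close> of
  \<open>ln (1 - t)\<close> there.
\<close>

lemma continuous_on_dilog_integrand:
  "continuous_on {..<1} (\<lambda>t::real. if t = 0 then -1 else ln (1 - t) / t)"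
proof (rule continuous_at_imp_continuous_on, rule ballI)
  fix x :: real
  assume x: "x \<in> {..<1}"
  let ?h = "\<lambda>t::real. if t = 0 then -1 else ln (1 - t) / t"
  show "isCont ?h x"
  proof (cases "x = 0")
    case True
    have "(\<lambda>t::real. ln (1 - t) / t) \<midarrow>0\<rightarrow> -1"
      by real_asymp
    then have "?h \<midarrow>0\<rightarrow> -1"
      by (rule Lim_transform_eventually) (auto simp: eventually_at_filter)
    then show ?thesis
      using True by (simp add: isCont_def)
  next
    case False
    have "\<forall>\<^sub>F t in nhds x. t \<noteq> 0"
      using False by (rule t1_space_nhds)
    then have "\<forall>\<^sub>F t in nhds x. ?h t = ln (1 - t) / t"
      by eventually_elim simp
    moreover have "isCont (\<lambda>t. ln (1 - t) / t) x"
      using x False by (intro continuous_intros) auto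
    ultimately show ?thesis
      by (rule isCont_cong[THEN iffD2])
  qed
qed

lemma Li2_has_real_derivative:
  assumes "x < 1"
  shows "(Li2 has_real_derivative (if x = 0 then 1 else - (ln (1 - x) / x))) (at x)"
proof -
  let ?h = "\<lambda>t::real. if t = 0 then -1 else ln (1 - t) / t"
  define p where "p = min x 0 - 1"
  obtain q where q: "max x 0 < q" "q < 1"
    using dense[of "max x 0" 1] assms by auto
  \<comment> \<open>Interval integrals range over the open interval, which excludes the endpoint \<open>0\<close>.\<close>
  have Li2_eq: "Li2 = (\<lambda>u. - (LBINT t=ereal 0..ereal u. ?h t))"
  proof
    fix u
    have "(LBINT t=ereal 0..ereal u. ln (1 - t) / t) = (LBINT t=ereal 0..ereal u. ?h t)"
      by (rule interval_integral_cong) (auto simp: einterval_iff min_def max_def split: if_splits)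
    then show "Li2 u = - (LBINT t=ereal 0..ereal u. ?h t)"
      by (simp add: Li2_def zero_ereal_def)
  qed
  have "((\<lambda>u. LBINT t=ereal 0..ereal u. ?h t) has_vector_derivative ?h x) (at x within {p..q})"
    using q
    by (intro interval_integral_FTC2 continuous_on_subset[OF continuous_on_dilog_integrand])
      (auto simp: p_def)
  moreover have "x \<in> interior {p..q}"
    using q by (auto simp: p_def)
  ultimately have "((\<lambda>u. LBINT t=ereal 0..ereal u. ?h t) has_real_derivative ?h x) (at x)"
    unfolding has_real_derivative_iff_has_vector_derivative by (simp only: at_within_interior)
  from DERIV_minus[OF this] show ?thesis
    unfolding Li2_eq by (cases "x = 0") simp_all
qed

lemma isCont_Li2: "x < 1 \<Longrightarrow> isCont Li2 x"
  using Li2_has_real_derivative by (rule DERIV_isCont)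

lemma Li2_0: "Li2 0 = 0"
  by (simp add: Li2_def zero_ereal_def)

lemma integral_ln_quotient_over_shift:
  fixes b r :: real
  assumes "b > 0" "r > 0"
  shows "set_integrable lborel (einterval 0 b) (\<lambda>x. (ln b - ln x) / (x + r))"
    and "(LBINT x=0..b. (ln b - ln x) / (x + r)) = - Li2 (- (b / r))"
proof -
  let ?f = "\<lambda>x. (ln b - ln x) / (x + r)"
  let ?G = "\<lambda>x. (ln b - ln x) * ln ((x + r) / r) - Li2 (- (x / r))"
  have D: "DERIV ?G x :> ?f x" if "0 < ereal x" "ereal x < ereal b" for x
  proof -
    have x: "x > 0" using that by simp
    have "- (x / r) < 0" using x assms by simp
    then have deriv_Li2: "((\<lambda>x. Li2 (- (x / r))) has_real_derivative
        - (ln (1 - - (x / r)) / (- (x / r))) * (- (1 / r))) (at x)"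
      by (intro DERIV_chain2[OF Li2_has_real_derivative[THEN DERIV_cong]])
        (auto intro!: derivative_eq_intros)
    have "1 - - (x / r) = (x + r) / r"
      using assms by (simp add: field_simps)
    with deriv_Li2 have "((\<lambda>x. Li2 (- (x / r))) has_real_derivative - (ln ((x + r) / r) / x)) (at x)"
      using x assms by simp
    moreover have "((\<lambda>x. (ln b - ln x) * ln ((x + r) / r)) has_real_derivative
        ?f x - ln ((x + r) / r) / x) (at x)"
    proof -
      have deriv_ln: "((\<lambda>x. ln ((x + r) / r)) has_real_derivative 1 / (x + r)) (at x)"
        using x assms by (auto intro!: derivative_eq_intros)
      have "((\<lambda>x. ln b - ln x) has_real_derivative - (1 / x)) (at x)"
        using x by (auto intro!: derivative_eq_intros)
      from DERIV_mult'[OF this deriv_ln] show ?thesis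
        by simp
    qed
    ultimately show ?thesis
      using DERIV_diff by fastforce
  qed
  have C: "isCont ?f x" if "0 < ereal x" "ereal x < ereal b" for x
    using that assms by (intro continuous_intros) auto
  have N: "AE x in lborel. 0 < ereal x \<longrightarrow> ereal x < ereal b \<longrightarrow> 0 \<le> ?f x"
    using assms by (auto intro!: AE_I2 divide_nonneg_pos)
  have Gb: "isCont ?G b"
    using assms
    by (intro continuous_intros isCont_o2[OF _ isCont_Li2]) (auto simp: pos_less_divide_eq)
  then have B: "((?G \<circ> real_of_ereal) \<longlongrightarrow> - Li2 (- (b / r))) (at_left (ereal b))"
    unfolding ereal_tendsto_simps1 by (simp add: isCont_def filterlim_at_split)
  have "isCont (\<lambda>x. Li2 (- (x / r))) 0"
    by (intro continuous_intros isCont_o2[OF _ isCont_Li2]) (use assms in auto)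
  then have "((\<lambda>x. Li2 (- (x / r))) \<longlongrightarrow> 0) (at_right 0)"
    by (simp add: isCont_def filterlim_at_split Li2_0)
  moreover have "((\<lambda>x. (ln b - ln x) * ln ((x + r) / r)) \<longlongrightarrow> 0) (at_right 0)"
    using assms by real_asymp
  ultimately have "(?G \<longlongrightarrow> 0) (at_right 0)"
    using tendsto_diff by fastforce
  then have A: "((?G \<circ> real_of_ereal) \<longlongrightarrow> 0) (at_right 0)"
    unfolding zero_ereal_def ereal_tendsto_simps1 .
  have less: "0 < ereal b" using assms by simp
  show "set_integrable lborel (einterval 0 b) ?f"
    by (rule interval_integral_FTC_nonneg(1)[OF less D C N A B])
  show "(LBINT x=0..b. ?f x) = - Li2 (- (b / r))"
    using interval_integral_FTC_nonneg(2)[OF less D C N A B] by simp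
qed

lemma integral_inverse_shift:
  fixes b r c :: real
  assumes "b > 0" "r > 0"
  shows "interval_lebesgue_integrable lborel 0 b (\<lambda>x. c / (x + r))"
    and "(LBINT x=0..b. c / (x + r)) = c * ln ((b + r) / r)"
proof -
  have cont: "continuous_on {0..b} (\<lambda>x. c / (x + r))"
    using assms by (intro continuous_intros) auto
  show "interval_lebesgue_integrable lborel 0 b (\<lambda>x. c / (x + r))"
    unfolding zero_ereal_def
    using assms by (intro interval_integrable_continuous_on cont) auto
  have "((\<lambda>x. c * ln (x + r)) has_vector_derivative c / (x + r)) (at x within {0..b})"
    if "x \<in> {0..b}" for x
    using that assms
    by (auto intro!: derivative_eq_intros
        simp: has_real_derivative_iff_has_vector_derivative[symmetric])
  then have "(LBINT x=ereal 0..ereal b. c / (x + r)) = c * ln (b + r) - c * ln (0 + r)"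
    using assms by (intro interval_integral_FTC_finite) (auto simp: cont)
  then show "(LBINT x=0..b. c / (x + r)) = c * ln ((b + r) / r)"
    using assms by (simp add: zero_ereal_def ln_div algebra_simps)
qed

theorem theorem3p2:
  fixes b r :: real
  assumes "b > 0" and "r > 0"
  shows "interval_lebesgue_integrable lborel 0 b (\<lambda>x. ln x / (x + r)) \<and>
    (LBINT x=0..b. ln x / (x + r)) = ln b * ln ((b + r) / r) + Li2 (- (b / r))"
proof -
  let ?f = "\<lambda>x. ln b / (x + r)" and ?g = "\<lambda>x. (ln b - ln x) / (x + r)"
  have split: "(\<lambda>x. ln x / (x + r)) = (\<lambda>x. ?f x - ?g x)"
    by (simp add: diff_divide_distrib)
  have f: "interval_lebesgue_integrable lborel 0 b ?f"
    using assms by (rule integral_inverse_shift)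
  have g: "interval_lebesgue_integrable lborel 0 b ?g"
    using integral_ln_quotient_over_shift(1)[OF assms] assms
    by (simp add: interval_lebesgue_integrable_def)
  show ?thesis
    unfolding split
    using interval_lebesgue_integral_diff[OF f g]
      integral_inverse_shift(2)[OF assms, of "ln b"] integral_ln_quotient_over_shift(2)[OF assms]
    by simp
qed

end
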